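(* Let $n,m$ be positive integers. Then $$A(K_n\uplus \overline{K}_m;x)=A(K_n;x)\,\widetilde{A}_m(x)+m\,x^m,\qquad\text{where}\quad \widetilde{A}_m(x)=\sum_{r=0}^{m}\binom{m}{r}x^{\min\{2r,\,m+1\}}.$$
   Context: All graphs are finite and simple with at least one vertex. $K_n$ is the complete graph on $n$ vertices and $\overline{K}_m$ its complement (the edgeless graph on $m$ vertices). The join $\Gamma_1\uplus\Gamma_2$ of two graphs with disjoint vertex sets is their disjoint union together with all edges joining a vertex of $\Gamma_1$ to a vertex of $\Gamma_2$. For a graph $\Gamma=(V,E)$ of order $n$, a vertex $v$ and $X\subseteq V$, $\delta_X(v)$ is the number of neighbours of $v$ in $X$, $\delta_1$ the maximum degree, $\bar S=V\setminus S$, and $\mathcal{K}=[-\delta_1,\delta_1]\cap\mathbb{Z}$. A nonempty $S\subseteq V$ is a defensive $k$-alliance if $\delta_S(v)\ge\delta_{\bar S}(v)+k$ for all $v\in S$; its exact index of alliance is $k_S=\max\{k\in\mathcal{K}: S \text{ is a defensive } k\text{-alliance}\}$. The alliance polynomial is $A(\Gamma;x)=\sum_{S} x^{n+k_S}$, the sum over all nonempty $S\subseteq V$ with induced subgraph $\langle S\rangle$ connected. *)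

theory Defs
  imports
    "HOL-Computational_Algebra.Polynomial"
    "Graph_Theory.Graph_Theory"
begin

text \<open>Finite simple graphs are represented as in the AFP entry Graph Theory: an undirected edge
  $uv$ is the pair of arcs $(u,v)$, $(v,u)$, and \<^locale>\<open>pair_graph\<close> collects
  well-formedness, finiteness, symmetry and absence of loops. The complete graph $K_n$ is
  \<^const>\<open>complete_digraph\<close>.\<close>

definition edgeless_graph :: "nat \<Rightarrow> 'a pair_pre_digraph \<Rightarrow> bool" where
  "edgeless_graph m G \<longleftrightarrow> pair_graph G \<and> card (pverts G) = m \<and> parcs G = {}"

text \<open>Only meaningful when the two vertex sets are disjoint.\<close>

definition graph_join :: "'a pair_pre_digraph \<Rightarrow> 'a pair_pre_digraph \<Rightarrow> 'a pair_pre_digraph"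
    (infixl \<open>\<uplus>\<^sub>G\<close> 65) where
  "G \<uplus>\<^sub>G H = \<lparr> pverts = pverts G \<union> pverts H,
      parcs = parcs G \<union> parcs H \<union> pverts G \<times> pverts H \<union> pverts H \<times> pverts G \<rparr>"

definition nbr_count :: "'a pair_pre_digraph \<Rightarrow> 'a set \<Rightarrow> 'a \<Rightarrow> nat" where
  "nbr_count G X v = card {u \<in> X. v \<rightarrow>\<^bsub>with_proj G\<^esub> u}"

text \<open>In a graph without parallel arcs the out-degree is the number of neighbours.\<close>

definition max_degree :: "'a pair_pre_digraph \<Rightarrow> nat" where
  "max_degree G = Max (out_degree (with_proj G) ` pverts G)"

definition defensive_alliance :: "'a pair_pre_digraph \<Rightarrow> int \<Rightarrow> 'a set \<Rightarrow> bool" where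
  "defensive_alliance G k S \<longleftrightarrow> S \<noteq> {} \<and> S \<subseteq> pverts G \<and>
     (\<forall>v\<in>S. int (nbr_count G S v) \<ge> int (nbr_count G (pverts G - S) v) + k)"

definition alliance_index :: "'a pair_pre_digraph \<Rightarrow> 'a set \<Rightarrow> int" where
  "alliance_index G S =
     Max {k \<in> {- int (max_degree G) .. int (max_degree G)}. defensive_alliance G k S}"

text \<open>The conversion to \<^typ>\<open>nat\<close> in the exponent does not truncate, since
  $k_S \ge -\delta_1 > -n$; see the lemma \<open>alliance_index_bounds\<close> below.\<close>

definition alliance_poly :: "'a pair_pre_digraph \<Rightarrow> int poly" where
  "alliance_poly G =
     (\<Sum>S | S \<subseteq> pverts G \<and> S \<noteq> {} \<and> Digraph_Component.connected (with_proj G \<restriction> S).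
        monom 1 (nat (int (card (pverts G)) + alliance_index G S)))"

definition alliance_poly_tilde :: "nat \<Rightarrow> int poly" where
  "alliance_poly_tilde m = (\<Sum>r = 0..m. monom (of_nat (m choose r)) (min (2 * r) (m + 1)))"

lemma pair_graph_join:
  assumes "pair_graph G" "pair_graph H" "pverts G \<inter> pverts H = {}"
  shows "pair_graph (G \<uplus>\<^sub>G H)"
proof -
  interpret G: pair_graph G by fact
  interpret H: pair_graph H by fact
  have "sym (parcs G)" "sym (parcs H)"
    using G.pair_sym_arcs H.pair_sym_arcs by (auto simp: symmetric_def)
  then have "sym (parcs (G \<uplus>\<^sub>G H))" by (auto simp: graph_join_def sym_def)
  then show ?thesis
    using assms(3) G.pair_finite_verts H.pair_finite_verts G.pair_finite_arcs H.pair_finite_arcs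
    by unfold_locales
      (auto simp: graph_join_def symmetric_def dest: G.in_arcsD1 G.in_arcsD2 H.in_arcsD1 H.in_arcsD2
        G.no_loops' H.no_loops')
qed

lemma out_degree_eq_nbr_count:
  assumes "pair_graph G"
  shows "out_degree (with_proj G) v = nbr_count G (pverts G) v"
proof -
  interpret pair_graph G by fact
  have "out_arcs (with_proj G) v = Pair v ` {u \<in> pverts G. v \<rightarrow>\<^bsub>with_proj G\<^esub> u}"
    using in_arcsD2 by (auto simp: out_arcs_def)
  then show ?thesis
    by (simp add: out_degree_def nbr_count_def card_image inj_on_def)
qed

lemma alliance_index_bounds:
  assumes "pair_graph G" "S \<subseteq> pverts G" "S \<noteq> {}"
  shows "defensive_alliance G (alliance_index G S) S"
    and "\<bar>alliance_index G S\<bar> \<le> int (max_degree G)"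
    and "int (card (pverts G)) + alliance_index G S > 0"
proof -
  interpret pair_graph G by fact
  let ?K = "{k \<in> {- int (max_degree G) .. int (max_degree G)}. defensive_alliance G k S}"
  have le: "nbr_count G (pverts G - S) v \<le> max_degree G" if "v \<in> S" for v
  proof -
    have "nbr_count G (pverts G - S) v \<le> nbr_count G (pverts G) v"
      unfolding nbr_count_def using pair_finite_verts by (intro card_mono) auto
    also have "\<dots> \<le> max_degree G"
      unfolding max_degree_def using that assms(2) pair_finite_verts
      by (intro Max_ge) (auto simp: out_degree_eq_nbr_count[OF assms(1), symmetric])
    finally show ?thesis .
  qed
  have "- int (max_degree G) \<in> ?K"
    using le assms by (fastforce simp: defensive_alliance_def)
  moreover have "finite ?K" by (rule finite_subset[of _ "{- int (max_degree G) .. int (max_degree G)}"]) auto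
  ultimately have "alliance_index G S \<in> ?K"
    unfolding alliance_index_def by (intro Max_in) auto
  then show "defensive_alliance G (alliance_index G S) S"
    and abs: "\<bar>alliance_index G S\<bar> \<le> int (max_degree G)" by auto
  have "out_degree (with_proj G) v < card (pverts G)" if "v \<in> pverts G" for v
    unfolding out_degree_eq_nbr_count[OF assms(1)] nbr_count_def
    using that pair_finite_verts by (intro psubset_card_mono) (auto dest: no_loops')
  then have "max_degree G < card (pverts G)"
    unfolding max_degree_def using assms(2,3) pair_finite_verts by (subst Max_less_iff) auto
  with abs show "int (card (pverts G)) + alliance_index G S > 0" by linarith
qed

end

theory Submission
  imports Defs
begin

text \<open>A connected vertex set of the join is either a single vertex of the edgeless part, or
  \<open>A \<union> B\<close> with \<open>A\<close> a nonempty set of \<open>s\<close> vertices of the complete part and \<open>B\<close> any set of \<open>r\<close>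
  vertices of the edgeless part. In the latter case the difference between inner and outer degree
  is \<open>2s + 2r - 1 - n - m\<close> at the vertices of \<open>A\<close> and \<open>2s - n\<close> at those of \<open>B\<close>, so the exponent of
  \<open>A \<union> B\<close> is \<open>(2s - 1) + min (2r) (m + 1)\<close>. The first summand is the exponent of \<open>A\<close> in the complete
  graph, hence the sum over all pairs \<open>(A, B)\<close> factors.\<close>

section \<open>Sums over subsets weighted by cardinality\<close>

lemma sum_Pow_card:
  fixes f :: "nat \<Rightarrow> 'b::comm_semiring_1"
  assumes "finite A"
  shows "(\<Sum>B\<in>Pow A. f (card B)) = (\<Sum>r = 0..card A. of_nat (card A choose r) * f r)"
proof -
  have "(\<Sum>B\<in>Pow A. f (card B)) = (\<Sum>r = 0..card A. \<Sum>B | B \<in> Pow A \<and> card B = r. f (card B))"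
    using assms by (intro sum.group[symmetric]) (auto intro: card_mono)
  also have "\<dots> = (\<Sum>r = 0..card A. of_nat (card A choose r) * f r)"
    using assms by (intro sum.cong) (simp_all add: n_subsets)
  finally show ?thesis .
qed

text \<open>The binomial coefficient \<open>m choose r\<close> counts the subsets of size
  \<open>r\<close>. Written without coefficients, the factor has one monomial per subset
  \<open>B\<close> of the edgeless part, which is the form needed to multiply it with a sum over
  sets \<open>A\<close>.\<close>

lemma alliance_poly_tilde_eq_sum_Pow:
  assumes "finite W"
  shows "alliance_poly_tilde (card W) = (\<Sum>B\<in>Pow W. monom 1 (min (2 * card B) (card W + 1)))"
  unfolding alliance_poly_tilde_def
  by (subst sum_Pow_card[OF assms, where f = "\<lambda>r. monom 1 (min (2 * r) (card W + 1))"])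
    (simp add: of_nat_monom mult_monom)

section \<open>Connectedness of induced subgraphs\<close>

text \<open>Any two vertices are joined by a walk through \<open>a\<close>. Arcs leaving
  \<open>a\<close> suffice, since connectedness is defined on the symmetric closure, which supplies
  the reversed arcs.\<close>

lemma connected_induce_if_universal_vertex:
  assumes "a \<in> S" and "\<And>v. v \<in> S - {a} \<Longrightarrow> (a, v) \<in> parcs G"
  shows "Digraph_Component.connected (with_proj G \<restriction> S)"
proof -
  let ?M = "mk_symmetric (with_proj G \<restriction> S)"
  have verts: "pverts ?M = S"
    by (simp add: mk_symmetric_def)
  have "wf_digraph (with_proj ?M)"
    by unfold_locales (auto simp: mk_symmetric_def)
  then interpret wf_digraph "with_proj ?M" .
  have center: "a \<rightarrow>\<^sup>*\<^bsub>with_proj ?M\<^esub> v" "v \<rightarrow>\<^sup>*\<^bsub>with_proj ?M\<^esub> a" if "v \<in> S" for v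
  proof -
    have "v = a \<or> a \<rightarrow>\<^bsub>with_proj ?M\<^esub> v \<and> v \<rightarrow>\<^bsub>with_proj ?M\<^esub> a"
      using assms that by (force simp: mk_symmetric_def)
    then show "a \<rightarrow>\<^sup>*\<^bsub>with_proj ?M\<^esub> v" "v \<rightarrow>\<^sup>*\<^bsub>with_proj ?M\<^esub> a"
      using that verts by (metis reachable_adjI reachable_refl with_proj_simps(1))+
  qed
  have "u \<rightarrow>\<^sup>*\<^bsub>with_proj ?M\<^esub> v" if "u \<in> S" "v \<in> S" for u v
    by (rule reachable_trans[OF center(2)[OF that(1)] center(1)[OF that(2)]])
  then show ?thesis
    unfolding Digraph_Component.connected_def strongly_connected_def with_proj_simps verts
    using assms(1) by blast
qed

text \<open>Without arcs inside \<open>S\<close>, reachability reduces to equality, so all vertices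
  coincide; connectedness also includes nonemptiness.\<close>

lemma connected_induce_independent:
  assumes "parcs G \<inter> S \<times> S = {}" and "Digraph_Component.connected (with_proj G \<restriction> S)"
  shows "is_singleton S"
proof -
  let ?M = "mk_symmetric (with_proj G \<restriction> S)"
  have ends: "arcs_ends (with_proj ?M) = {}" and verts: "pverts ?M = S"
    using assms(1) by (auto simp: mk_symmetric_def)
  have "u = v" if "(u, v) \<in> rtrancl_on S {}" for u v :: 'a
    using that by (induct) auto
  then have "u = v" if "u \<in> S" "v \<in> S" for u v
    using assms(2) that ends verts
    unfolding Digraph_Component.connected_def strongly_connected_def reachable_def
    by (metis with_proj_simps(1))
  moreover have "S \<noteq> {}"
    using assms(2) verts by (auto simp: Digraph_Component.connected_def strongly_connected_def)
  ultimately show ?thesis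
    by (meson is_singletonI')
qed

section \<open>Alliance indices and the polynomial of the complete graph\<close>

text \<open>Equality at the single vertex \<open>v\<close> rules out every larger value, so an index
  is found by exhibiting a vertex where the alliance condition is tight.\<close>

lemma alliance_index_eqI:
  assumes "pair_graph G" and "defensive_alliance G k S"
    and "v \<in> S" and "int (nbr_count G S v) = int (nbr_count G (pverts G - S) v) + k"
  shows "alliance_index G S = k"
proof -
  interpret pair_graph G by fact
  have S: "S \<subseteq> pverts G"
    using assms(2) by (simp add: defensive_alliance_def)
  have "nbr_count G X v \<le> max_degree G" if "X \<subseteq> pverts G" for X
  proof -
    have "nbr_count G X v \<le> nbr_count G (pverts G) v"
      unfolding nbr_count_def using pair_finite_verts that by (intro card_mono) auto
    also have "\<dots> \<le> max_degree G"
      unfolding max_degree_def using assms(3) S pair_finite_verts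
      by (intro Max_ge) (auto simp: out_degree_eq_nbr_count[OF assms(1), symmetric])
    finally show ?thesis .
  qed
  \<comment> \<open>As a difference of two numbers between 0 and the maximum degree,
    \<open>k\<close> lies in the range over which the index is maximised.\<close>
  from this[OF S] this[of "pverts G - S"] assms(4)
  have "k \<in> {- int (max_degree G) .. int (max_degree G)}" by auto
  then show ?thesis
    unfolding alliance_index_def using assms
    by (intro Max_eqI) (auto simp: defensive_alliance_def
        intro: finite_subset[of _ "{- int (max_degree G) .. int (max_degree G)}"])
qed

lemma nbr_count_universal:
  assumes "finite X" and "\<And>u. u \<in> X \<Longrightarrow> (v, u) \<in> parcs G \<longleftrightarrow> u \<noteq> v"
  shows "nbr_count G X v = card (X - {v})"
  unfolding nbr_count_def using assms(2) by (intro arg_cong[where f = card]) auto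

text \<open>Each vertex of \<open>A\<close> has \<open>card A - 1\<close> neighbours inside
  \<open>A\<close> and \<open>n - card A\<close> outside, so the condition is tight at all of them
  at once.\<close>

lemma alliance_index_complete:
  assumes "complete_digraph n (with_proj G)" and "A \<subseteq> pverts G" and "A \<noteq> {}"
  shows "alliance_index G A = 2 * int (card A) - 1 - int n"
proof -
  have G: "finite (pverts G)" "card (pverts G) = n"
    and arcs: "parcs G = {(u, v). (u, v) \<in> pverts G \<times> pverts G \<and> u \<noteq> v}"
    using assms(1) by (auto simp: complete_digraph_pair_def)
  have fin: "finite A" and pos: "card A > 0"
    using assms(2,3) G(1) by (auto simp: card_gt_0_iff intro: finite_subset)
  have le: "card A \<le> n"
    using card_mono[OF G(1) assms(2)] G(2) by simp
  have "nbr_count G A v = card A - 1 \<and> nbr_count G (pverts G - A) v = n - card A" if "v \<in> A" for v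
  proof -
    have "nbr_count G A v = card (A - {v})"
      using that assms(2) arcs fin by (intro nbr_count_universal) auto
    moreover have "nbr_count G (pverts G - A) v = card (pverts G - A - {v})"
      using that assms(2) arcs G(1) by (intro nbr_count_universal) auto
    ultimately show ?thesis
      using that assms(2) fin G by (simp add: card_Diff_subset)
  qed
  moreover obtain a where "a \<in> A" using assms(3) by auto
  ultimately show ?thesis
    using assms(2) pos le
    by (intro alliance_index_eqI[OF pair_graphI_complete[OF assms(1)], where v = a])
      (auto simp: defensive_alliance_def)
qed

text \<open>Every nonempty vertex set induces a connected subgraph, and adding the order
  \<open>n\<close> to the index cancels the term \<open>- n\<close>.\<close>

lemma alliance_poly_complete:
  assumes "complete_digraph n (with_proj G)"
  shows "alliance_poly G = (\<Sum>A\<in>Pow (pverts G) - {{}}. monom 1 (2 * card A - 1))"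
proof -
  have arcs: "parcs G = {(u, v). (u, v) \<in> pverts G \<times> pverts G \<and> u \<noteq> v}"
    and card: "card (pverts G) = n"
    using assms by (auto simp: complete_digraph_pair_def)
  have "Digraph_Component.connected (with_proj G \<restriction> A)" if "A \<subseteq> pverts G" "A \<noteq> {}" for A
  proof -
    obtain a where "a \<in> A" using \<open>A \<noteq> {}\<close> by auto
    with that arcs show ?thesis
      by (intro connected_induce_if_universal_vertex[of a]) auto
  qed
  then have sets: "{A. A \<subseteq> pverts G \<and> A \<noteq> {} \<and> Digraph_Component.connected (with_proj G \<restriction> A)}
      = Pow (pverts G) - {{}}" by auto
  have "nat (int n + alliance_index G A) = 2 * card A - 1" if "A \<in> Pow (pverts G) - {{}}" for A
    using that alliance_index_complete[OF assms, of A] by simp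
  then show ?thesis
    unfolding alliance_poly_def sets card by (intro sum.cong) simp_all
qed

section \<open>Adjacency and exponents in the join\<close>

locale complete_edgeless_join =
  fixes n m :: nat and G H :: "'a pair_pre_digraph"
  assumes complete: "complete_digraph n (with_proj G)"
    and edgeless: "edgeless_graph m H"
    and disjoint: "pverts G \<inter> pverts H = {}"
begin

lemma finite_pverts: "finite (pverts G)" "finite (pverts H)"
  and card_pverts: "card (pverts G) = n" "card (pverts H) = m"
proof -
  interpret H: pair_graph H using edgeless by (simp add: edgeless_graph_def)
  show "finite (pverts G)" "finite (pverts H)" "card (pverts G) = n" "card (pverts H) = m"
    using complete edgeless H.pair_finite_verts
    by (auto simp: complete_digraph_pair_def edgeless_graph_def)
qed

lemma pverts_join: "pverts (G \<uplus>\<^sub>G H) = pverts G \<union> pverts H"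
  by (simp add: graph_join_def)

lemma card_pverts_join: "card (pverts (G \<uplus>\<^sub>G H)) = n + m"
  using finite_pverts disjoint by (simp add: pverts_join card_Un_disjoint card_pverts)

lemma parcs_join_iff:
  "(u, v) \<in> parcs (G \<uplus>\<^sub>G H) \<longleftrightarrow> u \<in> pverts G \<union> pverts H \<and> v \<in> pverts G \<union> pverts H \<and> u \<noteq> v
    \<and> (u \<in> pverts G \<or> v \<in> pverts G)"
  using complete edgeless disjoint
  by (auto simp: graph_join_def complete_digraph_pair_def edgeless_graph_def)

lemma pair_graph_join_complete_edgeless: "pair_graph (G \<uplus>\<^sub>G H)"
  using complete edgeless disjoint
  by (intro pair_graph_join) (auto simp: edgeless_graph_def intro: pair_graphI_complete)

lemma nbr_count_complete_vertex:
  assumes "v \<in> pverts G" and "X \<subseteq> pverts G \<union> pverts H"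
  shows "nbr_count (G \<uplus>\<^sub>G H) X v = card (X - {v})"
  using assms finite_pverts
  by (intro nbr_count_universal) (auto simp: parcs_join_iff intro: finite_subset)

lemma nbr_count_edgeless_vertex:
  assumes "v \<in> pverts H" and "X \<subseteq> pverts G \<union> pverts H"
  shows "nbr_count (G \<uplus>\<^sub>G H) X v = card (X \<inter> pverts G)"
  unfolding nbr_count_def using assms disjoint
  by (intro arg_cong[where f = card]) (auto simp: parcs_join_iff)

text \<open>The index is the smaller of the differences at the vertices of \<open>A\<close> and of
  \<open>B\<close>; \<open>?k\<close> is this minimum in closed form, because replacing
  \<open>2 * card B\<close> by \<open>m + 1\<close> turns the first difference into the
  second.\<close>

lemma alliance_exponent_join:
  assumes "A \<subseteq> pverts G" and "A \<noteq> {}" and "B \<subseteq> pverts H"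
  shows "nat (int (n + m) + alliance_index (G \<uplus>\<^sub>G H) (A \<union> B))
    = (2 * card A - 1) + min (2 * card B) (m + 1)"
proof -
  let ?J = "G \<uplus>\<^sub>G H" and ?S = "A \<union> B"
  let ?k = "2 * int (card A) - 1 + int (min (2 * card B) (m + 1)) - int (n + m)"
  have fin: "finite A" "finite B" and pos: "card A > 0"
    using assms finite_pverts by (auto simp: card_gt_0_iff intro: finite_subset)
  have le: "card A \<le> n" "card B \<le> m"
    using assms finite_pverts card_mono card_pverts by metis+
  have card_S: "card ?S = card A + card B"
    using fin assms disjoint by (intro card_Un_disjoint) auto
  have S: "?S \<subseteq> pverts ?J" using assms by (auto simp: pverts_join)
  have card_compl: "card (pverts ?J - ?S) = n + m - (card A + card B)"
    using S fin card_S card_pverts_join by (simp add: card_Diff_subset)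
  have inA: "nbr_count ?J ?S v = card A + card B - 1"
      "nbr_count ?J (pverts ?J - ?S) v = n + m - (card A + card B)" if "v \<in> A" for v
  proof -
    have "v \<in> pverts G" using that assms by auto
    then show "nbr_count ?J ?S v = card A + card B - 1"
      using that S fin card_S by (subst nbr_count_complete_vertex) (auto simp: pverts_join)
    have "nbr_count ?J (pverts ?J - ?S) v = card (pverts ?J - ?S - {v})"
      using \<open>v \<in> pverts G\<close> by (intro nbr_count_complete_vertex) (auto simp: pverts_join)
    then show "nbr_count ?J (pverts ?J - ?S) v = n + m - (card A + card B)"
      using that card_compl by simp
  qed
  have inB: "nbr_count ?J ?S v = card A" "nbr_count ?J (pverts ?J - ?S) v = n - card A"
    if "v \<in> B" for v
  proof -
    have v: "v \<in> pverts H" using that assms by auto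
    have "?S \<inter> pverts G = A" "(pverts ?J - ?S) \<inter> pverts G = pverts G - A"
      using assms disjoint by (auto simp: pverts_join)
    then show "nbr_count ?J ?S v = card A" "nbr_count ?J (pverts ?J - ?S) v = n - card A"
      using S fin assms card_pverts v
      by (auto simp: nbr_count_edgeless_vertex pverts_join card_Diff_subset)
  qed
  have "alliance_index ?J ?S = ?k"
  \<comment> \<open>The difference at \<open>A\<close> is at most the one at \<open>B\<close>
    exactly in this case, so the tight vertex is taken from \<open>A\<close> here and from
    \<open>B\<close> otherwise. If \<open>B\<close> is empty, this case applies.\<close>
  proof (cases "2 * card B \<le> m + 1")
    case True
    obtain a where "a \<in> A" using assms by auto
    with True S pos le show ?thesis
      by (intro alliance_index_eqI[OF pair_graph_join_complete_edgeless, where v = a])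
        (auto simp: defensive_alliance_def inA inB)
  next
    case False
    \<comment> \<open>The failed inequality forces \<open>card B > 0\<close>.\<close>
    then obtain b where "b \<in> B" by fastforce
    with False S pos le show ?thesis
      by (intro alliance_index_eqI[OF pair_graph_join_complete_edgeless, where v = b])
        (auto simp: defensive_alliance_def inA inB)
  qed
  \<comment> \<open>As \<open>A\<close> is nonempty, the natural subtraction in
    \<open>2 * card A - 1\<close> does not truncate.\<close>
  then show ?thesis using pos by simp
qed

text \<open>The vertex \<open>w\<close> has no neighbour in \<open>{w}\<close> and all
  \<open>n\<close> vertices of the complete part outside it. The resulting exponent is
  \<open>n + m - n = m\<close>, the source of the extra summand.\<close>

lemma alliance_index_edgeless_vertex:
  assumes "w \<in> pverts H"
  shows "alliance_index (G \<uplus>\<^sub>G H) {w} = - int n"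
proof -
  have "{w} \<inter> pverts G = {}" "(pverts (G \<uplus>\<^sub>G H) - {w}) \<inter> pverts G = pverts G"
    using assms disjoint by (auto simp: pverts_join)
  then have "nbr_count (G \<uplus>\<^sub>G H) {w} w = 0" "nbr_count (G \<uplus>\<^sub>G H) (pverts (G \<uplus>\<^sub>G H) - {w}) w = n"
    using assms by (auto simp: nbr_count_edgeless_vertex pverts_join card_pverts)
  then show ?thesis
    using assms
    by (intro alliance_index_eqI[OF pair_graph_join_complete_edgeless, where v = w])
      (auto simp: defensive_alliance_def pverts_join)
qed

section \<open>Connected sets of the join and factorization\<close>

text \<open>A set missing the complete part is independent, hence connected only as a singleton; any
  other set contains a vertex adjacent to all its remaining vertices.\<close>

lemma connected_sets_join:
  "{S. S \<subseteq> pverts (G \<uplus>\<^sub>G H) \<and> S \<noteq> {} \<and> Digraph_Component.connected (with_proj (G \<uplus>\<^sub>G H) \<restriction> S)}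
    = (\<lambda>(A, B). A \<union> B) ` ((Pow (pverts G) - {{}}) \<times> Pow (pverts H)) \<union> (\<lambda>w. {w}) ` pverts H"
    (is "?C = ?P \<union> ?Q")
proof (intro subset_antisym subsetI)
  fix S assume S: "S \<in> ?C"
  show "S \<in> ?P \<union> ?Q"
  proof (cases "S \<inter> pverts G = {}")
    case True
    with S have "is_singleton S"
      by (intro connected_induce_independent[of "G \<uplus>\<^sub>G H"]) (auto simp: parcs_join_iff)
    with S True show ?thesis by (auto simp: is_singleton_def pverts_join)
  next
    case False
    have "S = S \<inter> pverts G \<union> S \<inter> pverts H" using S by (auto simp: pverts_join)
    with False have "S \<in> ?P"
      by (intro image_eqI[where x = "(S \<inter> pverts G, S \<inter> pverts H)"]) auto
    then show ?thesis ..
  qed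
next
  fix S assume S: "S \<in> ?P \<union> ?Q"
  \<comment> \<open>In both alternatives \<open>a\<close> is adjacent to every other vertex of
    \<open>S\<close>, vacuously so in the second.\<close>
  then obtain a where "a \<in> S" "a \<in> pverts G \<or> S = {a}" by auto
  moreover from S have "S \<subseteq> pverts G \<union> pverts H" by auto
  ultimately show "S \<in> ?C"
    by (auto simp: parcs_join_iff pverts_join intro!: connected_induce_if_universal_vertex[of a])
qed

lemma alliance_poly_join:
  "alliance_poly (G \<uplus>\<^sub>G H) = alliance_poly G * alliance_poly_tilde m + of_nat m * monom 1 m"
proof -
  let ?D = "(Pow (pverts G) - {{}}) \<times> Pow (pverts H)"
  let ?e = "\<lambda>S. monom (1::int) (nat (int (n + m) + alliance_index (G \<uplus>\<^sub>G H) S))"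
  \<comment> \<open>The union determines \<open>A\<close> and \<open>B\<close> as its intersections
    with the two disjoint vertex sets.\<close>
  have inj: "inj_on (\<lambda>(A, B). A \<union> B) ?D"
    using disjoint by (auto simp: inj_on_def) blast+
  have summand: "?e (A \<union> B) = monom 1 (2 * card A - 1) * monom 1 (min (2 * card B) (m + 1))"
    if "(A, B) \<in> ?D" for A B
  proof -
    from that have "A \<subseteq> pverts G" "A \<noteq> {}" "B \<subseteq> pverts H" by auto
    from alliance_exponent_join[OF this] show ?thesis by (simp only: mult_monom mult_1)
  qed
  \<comment> \<open>Meeting the complete part or not separates the two families, so the sum splits
    without overlap.\<close>
  have "S \<inter> pverts G \<noteq> {}" if "S \<in> (\<lambda>(A, B). A \<union> B) ` ?D" for S
    using that by auto
  moreover have "S \<inter> pverts G = {}" if "S \<in> (\<lambda>w. {w}) ` pverts H" for S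
    using that disjoint by auto
  ultimately have disj: "(\<lambda>(A, B). A \<union> B) ` ?D \<inter> (\<lambda>w. {w}) ` pverts H = {}"
    by (metis disjoint_iff)
  have "alliance_poly (G \<uplus>\<^sub>G H)
      = (\<Sum>S \<in> (\<lambda>(A, B). A \<union> B) ` ?D. ?e S) + (\<Sum>S \<in> (\<lambda>w. {w}) ` pverts H. ?e S)"
    unfolding alliance_poly_def connected_sets_join card_pverts_join
    using finite_pverts disj by (intro sum.union_disjoint) simp_all
  also have "(\<Sum>S \<in> (\<lambda>(A, B). A \<union> B) ` ?D. ?e S) = (\<Sum>(A, B) \<in> ?D. ?e (A \<union> B))"
    by (subst sum.reindex[OF inj]) (simp add: case_prod_beta)
  also have "\<dots> = (\<Sum>(A, B) \<in> ?D. monom 1 (2 * card A - 1) * monom 1 (min (2 * card B) (m + 1)))"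
    by (rule sum.cong[OF refl], unfold case_prod_beta, rule summand) (simp only: prod.collapse)
  \<comment> \<open>Each summand is a product of a term in \<open>A\<close> and a term in
    \<open>B\<close>, so the double sum is the product of the two single sums.\<close>
  also have "\<dots> = alliance_poly G * alliance_poly_tilde m"
    using alliance_poly_tilde_eq_sum_Pow[OF finite_pverts(2)]
    by (simp add: alliance_poly_complete[OF complete] card_pverts sum_product sum.cartesian_product)
  also have "(\<Sum>S \<in> (\<lambda>w. {w}) ` pverts H. ?e S) = (\<Sum>w \<in> pverts H. monom 1 m)"
    by (subst sum.reindex) (auto simp: alliance_index_edgeless_vertex)
  also have "\<dots> = of_nat m * monom 1 m"
    by (simp add: card_pverts)
  finally show ?thesis .
qed

end

theorem theorem2p13:
  fixes n m :: nat and G H :: "'a pair_pre_digraph"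
  assumes "n > 0" and "m > 0"
    and "complete_digraph n (with_proj G)"
    and "edgeless_graph m H"
    and "pverts G \<inter> pverts H = {}"
  shows "alliance_poly (G \<uplus>\<^sub>G H) =
    alliance_poly G * alliance_poly_tilde m + of_nat m * monom 1 m"
proof -
  interpret complete_edgeless_join n m G H
    using assms by unfold_locales
  show ?thesis by (rule alliance_poly_join)
qed

end
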